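(* Let $B=\prod_{i\in I}A_i$ be the direct product of a family of rings $(A_i)_{i\in I}$, where $B$ and all the $A_i$ are Marot rings. Then $B$ is an SP-ring if and only if all the $A_i$ are SP-rings and at most finitely many of them are not total quotient rings.
   Context: All rings are commutative with $1$. A regular element is a non-zerodivisor, and a regular ideal is an ideal containing a regular element. A Marot ring is a ring in which every regular ideal is generated by regular elements. A total quotient ring is a ring in which every regular element is a unit. An ideal $I$ is radical if $\sqrt{I}=I$ (the whole ring counts as a radical ideal). An SP-ring is a ring in which every regular ideal is a (finite) product of radical ideals. *)

theory Defs
  imports "HOL-Algebra.Product_Groups" "HOL-Algebra.Ideal_Product"
begin

text \<open>The zero ring is a \<open>cring\<close>; its only element is vacuously regular.\<close>

definition regular_elements :: "('a, 'm) ring_scheme \<Rightarrow> 'a set" where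
  "regular_elements R =
     {r \<in> carrier R. \<forall>s \<in> carrier R. r \<otimes>\<^bsub>R\<^esub> s = \<zero>\<^bsub>R\<^esub> \<longrightarrow> s = \<zero>\<^bsub>R\<^esub>}"

definition regular_ideal :: "'a set \<Rightarrow> ('a, 'm) ring_scheme \<Rightarrow> bool" where
  "regular_ideal J R \<longleftrightarrow> ideal J R \<and> J \<inter> regular_elements R \<noteq> {}"

definition ideal_sqrt :: "('a, 'm) ring_scheme \<Rightarrow> 'a set \<Rightarrow> 'a set" where
  "ideal_sqrt R J = {a \<in> carrier R. \<exists>n::nat. n > 0 \<and> a [^]\<^bsub>R\<^esub> n \<in> J}"

definition radical_ideal :: "'a set \<Rightarrow> ('a, 'm) ring_scheme \<Rightarrow> bool" where
  "radical_ideal J R \<longleftrightarrow> ideal J R \<and> ideal_sqrt R J = J"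

locale marot_ring = cring +
  assumes generated_by_regular:
    "regular_ideal J R \<Longrightarrow> \<exists>S \<subseteq> regular_elements R. J = Idl S"

locale total_quotient_ring = cring +
  assumes regular_is_unit: "regular_elements R \<subseteq> Units R"

text \<open>Finite products of ideals are taken in the commutative monoid of ideals of \<open>R\<close>. The empty
  product is the whole ring, which is itself a radical ideal, so allowing \<open>n = 0\<close> is harmless.\<close>

locale sp_ring = cring +
  assumes product_of_radical:
    "regular_ideal J R \<Longrightarrow>
       \<exists>(n::nat) K. (\<forall>k<n. radical_ideal (K k) R) \<and>
                    J = (\<Otimes>\<^bsub>ideals_set R\<^esub> k \<in> {..<n}. K k)"

definition product_ring :: "'i set \<Rightarrow> ('i \<Rightarrow> ('a, 'm) ring_scheme) \<Rightarrow> ('i \<Rightarrow> 'a) ring" where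
  "product_ring I A =
     \<lparr>carrier = (\<Pi>\<^sub>E i\<in>I. carrier (A i)),
      monoid.mult = (\<lambda>x y. \<lambda>i\<in>I. x i \<otimes>\<^bsub>A i\<^esub> y i),
      one = (\<lambda>i\<in>I. \<one>\<^bsub>A i\<^esub>),
      zero = (\<lambda>i\<in>I. \<zero>\<^bsub>A i\<^esub>),
      add = (\<lambda>x y. \<lambda>i\<in>I. x i \<oplus>\<^bsub>A i\<^esub> y i)\<rparr>"

lemma cring_product_ring:
  assumes "\<And>i. i \<in> I \<Longrightarrow> cring (A i)"
  shows "cring (product_ring I A)"
proof -
  let ?P = "product_ring I A"
  note rules = cring.cring_simprules[OF assms]
    monoid.r_one[OF ring.is_monoid[OF cring.axioms(1)[OF assms]]]
  note defs = product_ring_def PiE_iff extensional_def fun_eq_iff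
  show ?thesis
  proof (rule cringI)
    show "abelian_group ?P"
    proof (rule abelian_groupI)
      fix x assume "x \<in> carrier ?P"
      then show "\<exists>y\<in>carrier ?P. y \<oplus>\<^bsub>?P\<^esub> x = \<zero>\<^bsub>?P\<^esub>"
        by (intro bexI[of _ "\<lambda>i\<in>I. \<ominus>\<^bsub>A i\<^esub> x i"]) (auto simp: defs rules)
    qed (auto simp: defs rules)
    show "comm_monoid ?P"
      by (rule comm_monoidI) (auto simp: defs rules)
  qed (auto simp: defs rules)
qed

end

theory Submission
  imports Defs
begin

text \<open>
  Write \<open>P\<close> for the direct product. Everything rests on comparing an ideal of \<open>P\<close> with its images
  under the projections. Projections are surjective homomorphisms, so they carry ideals to ideals
  and products of ideals to products of ideals; they also carry radical ideals to radical ideals,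
  because each factor embeds (without unit) into \<open>P\<close> (\<open>proj_radical_ideal\<close>). Hence a factorization
  in \<open>P\<close> projects to one in each factor, which makes each factor an SP-ring (\<open>sp_ring_factor\<close>).

  If infinitely many factors had a regular non-unit \<open>a i\<close>, then some regular element of \<open>P\<close>
  would have powers of the \<open>a i\<close> with unbounded exponents as coordinates. A factorization of the
  principal ideal that it generates into \<open>m\<close> radical ideals would give one of the principal ideal
  of \<open>(a i)\<^sup>n\<close> for some \<open>n > m\<close> and some \<open>i\<close>. This is impossible
  (\<open>unit_if_pow_ideal_is_short_product\<close>): each radical factor contains \<open>(a i)\<^sup>n\<close>, hence
  \<open>a i\<close>, so the product contains \<open>(a i)\<^sup>m\<close>, which is then a multiple of \<open>(a i)\<^sup>n\<close>; cancelling
  the regular element \<open>(a i)\<^sup>m\<close> exhibits \<open>a i\<close> as a unit.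

  Conversely, suppose that all factors outside a finite set \<open>F\<close> are total quotient rings. A regular
  element of \<open>P\<close> is a unit at every coordinate outside \<open>F\<close>, so a regular ideal contains the
  idempotent that is \<open>1\<close> outside \<open>F\<close> and \<open>0\<close> on \<open>F\<close>. Every ideal containing this idempotent is a
  box, that is, the product of its projections (\<open>ideal_cofinite_eq_PiE\<close>). As \<open>F\<close> is finite, the
  factorizations of the finitely many relevant projections can be padded to a common length and
  assembled into a factorization in \<open>P\<close> (\<open>ideal_product_PiE\<close>).
\<close>

section \<open>Regular elements\<close>

lemma regular_closed: "r \<in> regular_elements R \<Longrightarrow> r \<in> carrier R"
  by (simp add: regular_elements_def)

lemma regular_cancel:
  "r \<in> regular_elements R \<Longrightarrow> s \<in> carrier R \<Longrightarrow> r \<otimes>\<^bsub>R\<^esub> s = \<zero>\<^bsub>R\<^esub> \<Longrightarrow> s = \<zero>\<^bsub>R\<^esub>"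
  unfolding regular_elements_def by blast

lemma regularI:
  "r \<in> carrier R \<Longrightarrow> (\<And>s. s \<in> carrier R \<Longrightarrow> r \<otimes>\<^bsub>R\<^esub> s = \<zero>\<^bsub>R\<^esub> \<Longrightarrow> s = \<zero>\<^bsub>R\<^esub>)
    \<Longrightarrow> r \<in> regular_elements R"
  unfolding regular_elements_def by blast

context cring
begin

lemma one_regular: "\<one> \<in> regular_elements R"
  by (rule regularI) simp_all

lemma regular_pow:
  assumes "r \<in> regular_elements R"
  shows "r [^] (n::nat) \<in> regular_elements R"
proof (induction n)
  case 0
  show ?case using one_regular by simp
next
  case (Suc n)
  note r = regular_closed[OF assms]
  show ?case
  proof (rule regularI)
    fix s assume s: "s \<in> carrier R" "r [^] Suc n \<otimes> s = \<zero>"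
    then have "r [^] n \<otimes> (r \<otimes> s) = \<zero>"
      using r by (simp add: m_assoc)
    then have "r \<otimes> s = \<zero>"
      by (rule regular_cancel[OF Suc m_closed[OF r s(1)]])
    then show "s = \<zero>"
      by (rule regular_cancel[OF assms s(1)])
  qed (use r in simp)
qed

end


section \<open>Finite products of ideals\<close>

definition ideal_product :: "('a, 'm) ring_scheme \<Rightarrow> (nat \<Rightarrow> 'a set) \<Rightarrow> nat \<Rightarrow> 'a set" where
  "ideal_product R K n = finprod (ideals_set R) K {..<n}"

context cring
begin

lemma ideal_product_0: "ideal_product R K 0 = carrier R"
proof -
  interpret M: comm_monoid "ideals_set R" by (rule ideals_set_is_comm_monoid)
  have "finprod (ideals_set R) K {} = \<one>\<^bsub>ideals_set R\<^esub>" by (rule M.finprod_empty)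
  then show ?thesis by (simp add: ideal_product_def) (simp add: ideals_set_def)
qed

lemma ideal_product_Suc:
  assumes "\<And>k. k < Suc n \<Longrightarrow> ideal (K k) R"
  shows "ideal_product R K (Suc n) = K n \<cdot> ideal_product R K n"
proof -
  interpret M: comm_monoid "ideals_set R" by (rule ideals_set_is_comm_monoid)
  have "ideal_product R K (Suc n) = K n \<otimes>\<^bsub>ideals_set R\<^esub> ideal_product R K n"
    unfolding ideal_product_def lessThan_Suc
    by (rule M.finprod_insert) (use assms in \<open>auto simp: ideals_set_def\<close>)
  then show ?thesis by (simp add: ideals_set_def)
qed

lemma ideal_product_ideal:
  assumes "\<And>k. k < n \<Longrightarrow> ideal (K k) R"
  shows "ideal (ideal_product R K n) R"
  using assms
  by (induction n) (auto simp: ideal_product_0 ideal_product_Suc oneideal ideal_prod_is_ideal)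

lemma ideal_product_subset:
  assumes "\<And>k. k < n \<Longrightarrow> ideal (K k) R" "k < n"
  shows "ideal_product R K n \<subseteq> K k"
  using assms
proof (induction n)
  case (Suc n)
  have "ideal_product R K (Suc n) \<subseteq> K n \<inter> ideal_product R K n"
    using Suc.prems ideal_prod_inter[of "K n" "ideal_product R K n"]
    by (simp add: ideal_product_Suc ideal_product_ideal)
  then show ?case
    using Suc by (cases "k = n") auto
qed simp

lemma pow_mem_ideal_product:
  assumes "\<And>k. k < n \<Longrightarrow> ideal (K k) R" "a \<in> carrier R" "\<And>k. k < n \<Longrightarrow> a \<in> K k"
  shows "a [^] n \<in> ideal_product R K n"
  using assms
proof (induction n)
  case (Suc n)
  then have "a \<otimes> a [^] n \<in> K n \<cdot> ideal_product R K n"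
    by (intro ideal_prod.prod) auto
  then show ?case
    using Suc.prems by (simp add: ideal_product_Suc m_comm)
qed (simp add: ideal_product_0)

text \<open>The whole ring is the neutral element, so factorizations may be brought to a common length.\<close>

lemma ideal_product_pad:
  assumes "\<And>k. k < n \<Longrightarrow> ideal (K k) R" "n \<le> m"
  shows "ideal_product R (\<lambda>k. if k < n then K k else carrier R) m = ideal_product R K n"
proof -
  interpret M: comm_monoid "ideals_set R" by (rule ideals_set_is_comm_monoid)
  show ?thesis
    unfolding ideal_product_def
    by (rule M.finprod_mono_neutral_cong_right)
      (use assms in \<open>auto simp: ideals_set_def oneideal\<close>)
qed

text \<open>Allowing the exponent \<open>0\<close> changes nothing: if \<open>a\<^sup>0 = 1\<close> lies in \<open>K\<close>, then \<open>K\<close> is the whole ring.\<close>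

lemma radical_ideal_iff:
  "radical_ideal K R \<longleftrightarrow>
     ideal K R \<and> (\<forall>a\<in>carrier R. \<forall>n::nat. a [^] n \<in> K \<longrightarrow> a \<in> K)"
proof
  assume rad: "radical_ideal K R"
  then interpret ideal K R by (simp add: radical_ideal_def)
  have "a \<in> K" if a: "a \<in> carrier R" "a [^] n \<in> K" for a and n :: nat
  proof (cases "n = 0")
    case True
    then show ?thesis using a one_imp_carrier by simp
  next
    case False
    then have "a \<in> ideal_sqrt R K" using a by (auto simp: ideal_sqrt_def)
    then show ?thesis using rad by (simp add: radical_ideal_def)
  qed
  then show "ideal K R \<and> (\<forall>a\<in>carrier R. \<forall>n::nat. a [^] n \<in> K \<longrightarrow> a \<in> K)"
    using is_ideal by blast
next
  assume K: "ideal K R \<and> (\<forall>a\<in>carrier R. \<forall>n::nat. a [^] n \<in> K \<longrightarrow> a \<in> K)"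
  then interpret ideal K R by simp
  have "a [^] (1::nat) \<in> K" if "a \<in> K" for a
    using that Icarr by simp
  then have "K \<subseteq> ideal_sqrt R K"
    using Icarr unfolding ideal_sqrt_def by blast
  moreover have "ideal_sqrt R K \<subseteq> K"
    using K unfolding ideal_sqrt_def by blast
  ultimately show "radical_ideal K R"
    using K unfolding radical_ideal_def by blast
qed

text \<open>Every radical factor contains \<open>r\<^sup>n\<close> and so \<open>r\<close>; the product of the \<open>m\<close> factors therefore contains
  \<open>r\<^sup>m\<close>. So \<open>r\<^sup>m\<close> is a multiple of the higher power \<open>r\<^sup>n\<close>, and \<open>r\<^sup>m\<close> can be cancelled.\<close>

lemma unit_if_pow_ideal_is_short_product:
  assumes r: "r \<in> regular_elements R" and "m < n"
    and rad: "\<And>k. k < m \<Longrightarrow> radical_ideal (L k) R"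
    and eq: "PIdl (r [^] n) = ideal_product R L m"
  shows "r \<in> Units R"
proof -
  note rc [simp] = regular_closed[OF r]
  have L: "ideal (L k) R" if "k < m" for k
    using rad that by (simp add: radical_ideal_def)
  have "r [^] n \<in> L k" if "k < m" for k
    using cgenideal_self[of "r [^] n"] ideal_product_subset[of m L k, OF L that] eq by auto
  then have "r \<in> L k" if "k < m" for k
    using rad[OF that] rc that unfolding radical_ideal_iff by blast
  then have "r [^] m \<in> PIdl (r [^] n)"
    using pow_mem_ideal_product[of m L r, OF L rc] eq by simp
  then obtain x where x [simp]: "x \<in> carrier R" and rm: "r [^] m = x \<otimes> r [^] n"
    unfolding cgenideal_def by auto
  obtain d where n: "n = m + Suc d"
    using \<open>m < n\<close> less_iff_Suc_add by auto
  define y where "y = x \<otimes> r [^] d"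
  have [simp]: "y \<in> carrier R" by (simp add: y_def)
  have "r [^] m = r [^] m \<otimes> (r \<otimes> y)"
    using rm unfolding n y_def nat_pow_mult[OF rc, symmetric] by (simp add: m_ac)
  then have "r [^] m \<otimes> (\<one> \<ominus> r \<otimes> y) = \<zero>"
    by (simp add: minus_eq r_distr r_minus r_neg flip: m_assoc)
  then have "\<one> \<ominus> r \<otimes> y = \<zero>"
    by (intro regular_cancel[OF regular_pow[OF r, of m], of "\<one> \<ominus> r \<otimes> y"] minus_closed) simp_all
  moreover have "\<one> = (\<one> \<ominus> r \<otimes> y) \<oplus> r \<otimes> y"
    by (simp add: minus_eq a_assoc l_neg)
  ultimately have "r \<otimes> y = \<one>" by simp
  then show ?thesis
    by (auto simp: Units_def m_comm intro!: bexI[of _ y])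
qed

end

context ring_hom_cring
begin

lemma hom_pow: "a \<in> carrier R \<Longrightarrow> h (a [^] (n::nat)) = h a [^]\<^bsub>S\<^esub> n"
  by (induction n) simp_all

lemma ideal_image:
  assumes surj: "h ` carrier R = carrier S" and K: "ideal K R"
  shows "ideal (h ` K) S"
proof -
  interpret K: ideal K R by (rule K)
  show ?thesis
  proof (rule idealI[OF S.ring_axioms])
    show "subgroup (h ` K) (add_monoid S)"
    proof (rule subgroup.intro)
      fix x y assume "x \<in> h ` K" "y \<in> h ` K"
      then obtain a b where "a \<in> K" "b \<in> K" "x = h a" "y = h b" by auto
      then show "x \<otimes>\<^bsub>add_monoid S\<^esub> y \<in> h ` K"
        using K.a_closed[of a b] K.Icarr by (auto intro!: image_eqI[of _ _ "a \<oplus> b"])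
    next
      fix x assume "x \<in> h ` K"
      then obtain a where "a \<in> K" "x = h a" by auto
      then show "inv\<^bsub>add_monoid S\<^esub> x \<in> h ` K"
        using K.a_inv_closed[of a] K.Icarr
        by (auto intro!: image_eqI[of _ _ "\<ominus> a"] simp: a_inv_def[symmetric])
    qed (use K.Icarr K.zero_closed in \<open>auto intro!: image_eqI[of _ _ \<zero>]\<close>)
  next
    fix a x assume "a \<in> h ` K" and "x \<in> carrier S"
    then obtain b y where "b \<in> K" "a = h b" "y \<in> carrier R" "x = h y"
      using surj by blast
    then show "x \<otimes>\<^bsub>S\<^esub> a \<in> h ` K" "a \<otimes>\<^bsub>S\<^esub> x \<in> h ` K"
      using K.I_l_closed[of b y] K.I_r_closed[of b y] K.Icarr
      by (auto intro: image_eqI[of _ _ "y \<otimes> b"] image_eqI[of _ _ "b \<otimes> y"])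
  qed
qed

lemma image_ideal_prod:
  assumes "ideal K R" "ideal L R"
  shows "h ` (K \<cdot> L) = h ` K \<cdot>\<^bsub>S\<^esub> h ` L"
proof -
  have carr: "K \<subseteq> carrier R" "L \<subseteq> carrier R" "K \<cdot> L \<subseteq> carrier R"
    using assms ideal.Icarr R.ideal_prod_in_carrier by fast+
  have "h s \<in> h ` K \<cdot>\<^bsub>S\<^esub> h ` L" if "s \<in> K \<cdot> L" for s
    using that
  proof induction
    case (prod i j)
    then have "h (i \<otimes> j) = h i \<otimes>\<^bsub>S\<^esub> h j" using carr by (intro hom_mult) auto
    then show ?case using prod by (auto intro!: ideal_prod.prod)
  next
    case (sum s t)
    then show ?case using carr by (auto simp: subset_iff intro!: ideal_prod.sum)
  qed
  moreover have "s \<in> h ` (K \<cdot> L)" if "s \<in> h ` K \<cdot>\<^bsub>S\<^esub> h ` L" for s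
    using that
  proof induction
    case (prod i j)
    then obtain a b where ab: "a \<in> K" "b \<in> L" "i = h a" "j = h b" by auto
    then have "h (a \<otimes> b) = h a \<otimes>\<^bsub>S\<^esub> h b" using carr by (intro hom_mult) auto
    then show ?case
      using ab by (auto intro!: image_eqI[of _ _ "a \<otimes> b"] ideal_prod.prod)
  next
    case (sum s t)
    then obtain a b where "a \<in> K \<cdot> L" "b \<in> K \<cdot> L" "s = h a" "t = h b" by auto
    then show ?case
      using carr by (auto simp: subset_iff intro!: image_eqI[of _ _ "a \<oplus> b"] ideal_prod.sum)
  qed
  ultimately show ?thesis by blast
qed

lemma image_ideal_product:
  assumes surj: "h ` carrier R = carrier S" and "\<And>k. k < n \<Longrightarrow> ideal (K k) R"
  shows "h ` ideal_product R K n = ideal_product S (\<lambda>k. h ` K k) n"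
  using assms(2)
proof (induction n)
  case 0
  then show ?case by (simp add: R.ideal_product_0 S.ideal_product_0 surj)
next
  case (Suc n)
  then show ?case
    by (simp add: R.ideal_product_Suc S.ideal_product_Suc ideal_image[OF surj]
        image_ideal_prod R.ideal_product_ideal)
qed

lemma image_cgenideal:
  assumes surj: "h ` carrier R = carrier S" and "a \<in> carrier R"
  shows "h ` (PIdl a) = PIdl\<^bsub>S\<^esub> (h a)"
proof -
  have "h ` (PIdl a) = (\<lambda>x. h x \<otimes>\<^bsub>S\<^esub> h a) ` carrier R"
    using assms(2) by (auto simp: cgenideal_def image_iff) (metis hom_mult)
  also have "\<dots> = (\<lambda>y. y \<otimes>\<^bsub>S\<^esub> h a) ` h ` carrier R"
    by (simp add: image_image)
  also have "\<dots> = PIdl\<^bsub>S\<^esub> (h a)"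
    unfolding surj by (auto simp: cgenideal_def)
  finally show ?thesis .
qed

end


section \<open>Ideals of a direct product\<close>

locale cring_family =
  fixes I :: "'i set" and A :: "'i \<Rightarrow> ('a, 'm) ring_scheme"
  assumes cring_factor: "i \<in> I \<Longrightarrow> cring (A i)"
begin

abbreviation P :: "('i \<Rightarrow> 'a) ring" where "P \<equiv> product_ring I A"

sublocale P: cring P
  by (rule cring_product_ring) (rule cring_factor)

lemmas factor_simps [simp] =
  cring.cring_simprules(1-6,8,9,12,16,26,27)[OF cring_factor]
  monoid.r_one[OF ring.is_monoid[OF cring.axioms(1)[OF cring_factor]]]

lemma carrier_P: "carrier P = (\<Pi>\<^sub>E i\<in>I. carrier (A i))"
  and mult_P: "x \<otimes>\<^bsub>P\<^esub> y = (\<lambda>i\<in>I. x i \<otimes>\<^bsub>A i\<^esub> y i)"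
  and add_P: "x \<oplus>\<^bsub>P\<^esub> y = (\<lambda>i\<in>I. x i \<oplus>\<^bsub>A i\<^esub> y i)"
  and one_P: "\<one>\<^bsub>P\<^esub> = (\<lambda>i\<in>I. \<one>\<^bsub>A i\<^esub>)"
  and zero_P: "\<zero>\<^bsub>P\<^esub> = (\<lambda>i\<in>I. \<zero>\<^bsub>A i\<^esub>)"
  by (simp_all add: product_ring_def)

lemmas P_defs = carrier_P mult_P add_P one_P zero_P

definition single :: "'i \<Rightarrow> 'a \<Rightarrow> 'i \<Rightarrow> 'a" where
  "single i a = (\<lambda>j\<in>I. if j = i then a else \<zero>\<^bsub>A j\<^esub>)"

lemma single_carrier: "i \<in> I \<Longrightarrow> a \<in> carrier (A i) \<Longrightarrow> single i a \<in> carrier P"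
  by (auto simp: single_def carrier_P)

lemma single_self: "i \<in> I \<Longrightarrow> single i a i = a"
  by (simp add: single_def)

lemma proj_hom:
  assumes "i \<in> I"
  shows "ring_hom_cring P (A i) (\<lambda>x. x i)"
proof -
  have "(\<lambda>x. x i) \<in> ring_hom P (A i)"
    using assms by (intro ring_hom_memI) (auto simp: P_defs)
  then show ?thesis
    using assms P.cring_axioms cring_factor
    by (simp add: ring_hom_cring_def ring_hom_cring_axioms_def)
qed

lemma proj_surj:
  assumes "i \<in> I"
  shows "(\<lambda>x. x i) ` carrier P = carrier (A i)"
proof
  show "carrier (A i) \<subseteq> (\<lambda>x. x i) ` carrier P"
  proof
    fix a assume "a \<in> carrier (A i)"
    then show "a \<in> (\<lambda>x. x i) ` carrier P"
      using single_carrier[OF assms] single_self[OF assms, of a, symmetric] by (intro image_eqI)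
  qed
qed (use assms in \<open>auto simp: carrier_P\<close>)

text \<open>A zero divisor in one coordinate is one in \<open>P\<close>: its annihilating partner can be extended by zero.\<close>

lemma regular_elements_P: "regular_elements P = (\<Pi>\<^sub>E i\<in>I. regular_elements (A i))"
proof (intro equalityI subsetI)
  fix r assume r: "r \<in> regular_elements P"
  note rc = regular_closed[OF r]
  have "r i \<in> regular_elements (A i)" if i: "i \<in> I" for i
  proof (rule regularI)
    show "r i \<in> carrier (A i)" using rc i by (auto simp: carrier_P)
    fix s assume s: "s \<in> carrier (A i)" "r i \<otimes>\<^bsub>A i\<^esub> s = \<zero>\<^bsub>A i\<^esub>"
    have "r \<otimes>\<^bsub>P\<^esub> single i s = \<zero>\<^bsub>P\<^esub>"
      using s i rc by (auto simp: P_defs single_def fun_eq_iff PiE_iff)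
    then have "single i s = \<zero>\<^bsub>P\<^esub>"
      by (rule regular_cancel[OF r single_carrier[OF i s(1)]])
    then have "single i s i = \<zero>\<^bsub>P\<^esub> i" by (rule fun_cong)
    then show "s = \<zero>\<^bsub>A i\<^esub>"
      using i by (simp add: single_def zero_P)
  qed
  then show "r \<in> (\<Pi>\<^sub>E i\<in>I. regular_elements (A i))"
    using rc by (auto simp: carrier_P)
next
  fix r assume r: "r \<in> (\<Pi>\<^sub>E i\<in>I. regular_elements (A i))"
  show "r \<in> regular_elements P"
  proof (rule regularI)
    show "r \<in> carrier P"
      using r regular_closed by (fastforce simp: carrier_P PiE_iff)
    fix s assume s: "s \<in> carrier P" "r \<otimes>\<^bsub>P\<^esub> s = \<zero>\<^bsub>P\<^esub>"
    show "s = \<zero>\<^bsub>P\<^esub>"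
    proof (rule PiE_ext)
      show "s \<in> (\<Pi>\<^sub>E i\<in>I. carrier (A i))" "\<zero>\<^bsub>P\<^esub> \<in> (\<Pi>\<^sub>E i\<in>I. carrier (A i))"
        using s(1) P.zero_closed by (simp_all only: carrier_P)
      fix i assume i: "i \<in> I"
      have "r i \<otimes>\<^bsub>A i\<^esub> s i = \<zero>\<^bsub>A i\<^esub>"
        using i fun_cong[OF s(2), of i] by (simp add: mult_P zero_P)
      moreover have "r i \<in> regular_elements (A i)" "s i \<in> carrier (A i)"
        using r s(1) i by (auto simp: carrier_P)
      ultimately show "s i = \<zero>\<^bsub>P\<^esub> i"
        using i regular_cancel[of "r i" "A i" "s i"] by (simp add: zero_P)
    qed
  qed
qed

lemma ideal_PiE:
  assumes "\<And>i. i \<in> I \<Longrightarrow> ideal (K i) (A i)"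
  shows "ideal (Pi\<^sub>E I K) P"
proof -
  note carr = ideal.Icarr[OF assms]
  note cl = additive_subgroup.a_closed[OF ideal.axioms(1)[OF assms]]
    additive_subgroup.zero_closed[OF ideal.axioms(1)[OF assms]]
    additive_subgroup.a_inv_closed[OF ideal.axioms(1)[OF assms]]
    ideal.I_l_closed[OF assms] ideal.I_r_closed[OF assms]
  show ?thesis
  proof (rule idealI[OF P.ring_axioms])
    show "subgroup (Pi\<^sub>E I K) (add_monoid P)"
    proof (rule P.add.subgroupI)
      show "Pi\<^sub>E I K \<noteq> {}"
        using cl(2) by (force simp: PiE_eq_empty_iff)
    next
      fix x assume x: "x \<in> Pi\<^sub>E I K"
      have xc: "x \<in> carrier P" using x carr by (auto simp: carrier_P)
      have "(\<lambda>i\<in>I. \<ominus>\<^bsub>A i\<^esub> x i) = \<ominus>\<^bsub>P\<^esub> x"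
        using xc by (intro P.minus_equality[symmetric]) (auto simp: P_defs fun_eq_iff PiE_iff)
      moreover have "(\<lambda>i\<in>I. \<ominus>\<^bsub>A i\<^esub> x i) \<in> Pi\<^sub>E I K"
        using x cl(3) by (auto simp: PiE_iff)
      ultimately show "\<ominus>\<^bsub>P\<^esub> x \<in> Pi\<^sub>E I K"
        by simp
    qed (use carr cl in \<open>auto simp: P_defs PiE_iff\<close>)
  qed (use cl in \<open>auto simp: P_defs PiE_iff\<close>)
qed

lemma proj_PiE:
  assumes "\<And>j. j \<in> I \<Longrightarrow> ideal (K j) (A j)" "i \<in> I"
  shows "(\<lambda>x. x i) ` Pi\<^sub>E I K = K i"
proof
  show "K i \<subseteq> (\<lambda>x. x i) ` Pi\<^sub>E I K"
  proof
    fix a assume "a \<in> K i"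
    then have "single i a \<in> Pi\<^sub>E I K"
      using additive_subgroup.zero_closed[OF ideal.axioms(1)[OF assms(1)]]
      by (auto simp: single_def)
    then show "a \<in> (\<lambda>x. x i) ` Pi\<^sub>E I K"
      using single_self[OF assms(2)] by (metis image_eqI)
  qed
qed (use assms(2) in auto)

text \<open>The idempotents of \<open>P\<close> that cut out a set of coordinates.\<close>

definition coord_idem :: "'i set \<Rightarrow> 'i \<Rightarrow> 'a" where
  "coord_idem T = (\<lambda>i\<in>I. if i \<in> T then \<one>\<^bsub>A i\<^esub> else \<zero>\<^bsub>A i\<^esub>)"

lemma coord_idem_carrier: "coord_idem T \<in> carrier P"
  by (auto simp: coord_idem_def carrier_P)

lemma coord_idem_mult_self: "coord_idem T \<otimes>\<^bsub>P\<^esub> coord_idem T = coord_idem T"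
  by (auto simp: coord_idem_def P_defs fun_eq_iff)

text \<open>Let \<open>x\<close> have all its coordinates in the projections of \<open>J\<close>. The part of \<open>x\<close> outside \<open>F\<close> lies in \<open>J\<close>
  since it is a multiple of the given idempotent. The coordinates in \<open>F\<close> are added one at a time:
  at \<open>j\<close>, some \<open>y \<in> J\<close> agrees with \<open>x\<close>, and multiplying \<open>y\<close> by the idempotent of \<open>j\<close> isolates this
  coordinate. Only finitely many steps are possible, which is why \<open>F\<close> must be finite.\<close>

lemma ideal_cofinite_eq_PiE:
  assumes J: "ideal J P" and F: "finite F" and e: "coord_idem (- F) \<in> J"
  shows "J = (\<Pi>\<^sub>E i\<in>I. (\<lambda>x. x i) ` J)"
proof
  interpret J: ideal J P by (rule J)
  show "J \<subseteq> (\<Pi>\<^sub>E i\<in>I. (\<lambda>x. x i) ` J)"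
    using J.Icarr by (auto simp: carrier_P)
  show "(\<Pi>\<^sub>E i\<in>I. (\<lambda>x. x i) ` J) \<subseteq> J"
  proof
    fix x assume x: "x \<in> (\<Pi>\<^sub>E i\<in>I. (\<lambda>x. x i) ` J)"
    have xc: "x \<in> carrier P"
      using x J.Icarr by (fastforce simp: carrier_P PiE_iff)
    have "x \<otimes>\<^bsub>P\<^esub> coord_idem (- F \<union> G) \<in> J" if "finite G" for G
      using that
    proof induction
      case empty
      then show ?case using J.I_l_closed[OF e xc] by simp
    next
      case (insert j G)
      show ?case
      proof (cases "j \<in> I \<and> j \<in> F")
        case True
        then obtain y where y: "y \<in> J" "y j = x j" using x by (fastforce simp: PiE_iff)
        have "x \<otimes>\<^bsub>P\<^esub> coord_idem (- F \<union> insert j G)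
            = x \<otimes>\<^bsub>P\<^esub> coord_idem (- F \<union> G) \<oplus>\<^bsub>P\<^esub> coord_idem {j} \<otimes>\<^bsub>P\<^esub> y"
          using xc J.Icarr[OF y(1)] y(2) True insert.hyps
          by (auto simp: P_defs coord_idem_def fun_eq_iff PiE_iff)
        then show ?thesis
          using J.I_l_closed[OF y(1) coord_idem_carrier, of "{j}"] insert.IH by simp
      next
        case False
        then have "coord_idem (- F \<union> insert j G) = coord_idem (- F \<union> G)"
          by (auto simp: coord_idem_def fun_eq_iff)
        then show ?thesis using insert.IH by simp
      qed
    qed
    from this[OF F] have "x \<otimes>\<^bsub>P\<^esub> coord_idem UNIV \<in> J" by simp
    moreover have "coord_idem UNIV = \<one>\<^bsub>P\<^esub>" by (simp add: coord_idem_def one_P)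
    ultimately show "x \<in> J" using xc by simp
  qed
qed

text \<open>If \<open>a\<^sup>n\<close> is the \<open>i\<close>-th coordinate of some \<open>x \<in> K\<close>, then multiplying \<open>x\<close> by \<open>single i a\<close> clears all
  other coordinates and shows \<open>(single i a)\<^sup>n\<^sup>+\<^sup>1 \<in> K\<close>. So \<open>single i a \<in> K\<close> as \<open>K\<close> is radical. For general
  surjections the image of a radical ideal need not be radical.\<close>

lemma proj_radical_ideal:
  assumes K: "radical_ideal K P" and i: "i \<in> I"
  shows "radical_ideal ((\<lambda>x. x i) ` K) (A i)"
proof -
  interpret K: ideal K P using K by (simp add: radical_ideal_def)
  interpret Ai: cring "A i" using i by (rule cring_factor)
  interpret h: ring_hom_cring P "A i" "\<lambda>x. x i" using i by (rule proj_hom)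
  have "a \<in> (\<lambda>x. x i) ` K"
    if a: "a \<in> carrier (A i)" and n: "a [^]\<^bsub>A i\<^esub> (n::nat) \<in> (\<lambda>x. x i) ` K" for a n
  proof -
    obtain x where x: "x \<in> K" "x i = a [^]\<^bsub>A i\<^esub> n" using n by auto
    \<comment> \<open>This fails for exponent \<open>0\<close>, since \<open>single i\<close> does not preserve the unit.\<close>
    have pow: "single i a [^]\<^bsub>P\<^esub> Suc n = single i (a [^]\<^bsub>A i\<^esub> Suc n)" for n
    proof (induction n)
      case 0
      show ?case using single_carrier[OF i a] a by simp
    next
      case (Suc n)
      have "single i a [^]\<^bsub>P\<^esub> Suc (Suc n) = single i (a [^]\<^bsub>A i\<^esub> Suc n) \<otimes>\<^bsub>P\<^esub> single i a"
        unfolding Suc[symmetric] by simp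
      also have "\<dots> = single i (a [^]\<^bsub>A i\<^esub> Suc (Suc n))"
        by (auto simp: single_def mult_P fun_eq_iff)
      finally show ?case .
    qed
    have "single i a [^]\<^bsub>P\<^esub> Suc n = single i a \<otimes>\<^bsub>P\<^esub> x"
      unfolding pow using x K.Icarr[OF x(1)] i a
      by (auto simp: single_def mult_P fun_eq_iff carrier_P PiE_iff Ai.m_comm)
    then have "single i a [^]\<^bsub>P\<^esub> Suc n \<in> K"
      using K.I_l_closed[OF x(1) single_carrier[OF i a]] by simp
    then have "single i a \<in> K"
      using K single_carrier[OF i a] unfolding P.radical_ideal_iff by blast
    then show ?thesis
      using single_self[OF i] by (metis image_eqI)
  qed
  then show ?thesis
    using h.ideal_image[OF proj_surj[OF i] K.is_ideal] unfolding Ai.radical_ideal_iff by blast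
qed

lemma radical_PiE:
  assumes "\<And>i. i \<in> I \<Longrightarrow> radical_ideal (K i) (A i)"
  shows "radical_ideal (Pi\<^sub>E I K) P"
  unfolding P.radical_ideal_iff
proof (intro conjI ballI allI impI)
  show "ideal (Pi\<^sub>E I K) P"
    using assms by (intro ideal_PiE) (simp add: radical_ideal_def)
  fix x n assume x: "x \<in> carrier P" and n: "x [^]\<^bsub>P\<^esub> (n::nat) \<in> Pi\<^sub>E I K"
  have "x i \<in> K i" if i: "i \<in> I" for i
  proof -
    interpret h: ring_hom_cring P "A i" "\<lambda>x. x i" using i by (rule proj_hom)
    have "x i [^]\<^bsub>A i\<^esub> n \<in> K i"
      using n i x h.hom_pow[OF x, of n] by (auto simp: PiE_iff)
    moreover have "x i \<in> carrier (A i)" using x i by (auto simp: carrier_P)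
    ultimately show ?thesis
      using assms[OF i] unfolding h.S.radical_ideal_iff by blast
  qed
  then show "x \<in> Pi\<^sub>E I K" using x by (auto simp: carrier_P)
qed

lemma proj_ideal_product:
  assumes "i \<in> I" "\<And>k. k < n \<Longrightarrow> ideal (K k) P"
  shows "(\<lambda>x. x i) ` ideal_product P K n = ideal_product (A i) (\<lambda>k. (\<lambda>x. x i) ` K k) n"
  using ring_hom_cring.image_ideal_product[OF proj_hom[OF assms(1)] proj_surj[OF assms(1)]] assms(2)
  by blast

text \<open>The idempotent that is \<open>1\<close> outside \<open>F\<close> lies in every box and equals its own powers, so it lies in
  the product as well. Hence the product of the boxes is again a box and can be compared with the
  right-hand side one coordinate at a time.\<close>

lemma ideal_product_PiE:
  assumes K: "\<And>i k. i \<in> I \<Longrightarrow> k < n \<Longrightarrow> ideal (K i k) (A i)"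
    and F: "finite F" and triv: "\<And>i k. i \<in> I - F \<Longrightarrow> k < n \<Longrightarrow> K i k = carrier (A i)"
  shows "ideal_product P (\<lambda>k. \<Pi>\<^sub>E i\<in>I. K i k) n = (\<Pi>\<^sub>E i\<in>I. ideal_product (A i) (K i) n)"
proof -
  let ?Q = "ideal_product P (\<lambda>k. \<Pi>\<^sub>E i\<in>I. K i k) n" and ?e = "coord_idem (- F)"
  have box: "ideal (\<Pi>\<^sub>E i\<in>I. K i k) P" if "k < n" for k
    using K that by (intro ideal_PiE) auto
  have Q: "ideal ?Q P" using box by (rule P.ideal_product_ideal)
  have "?e \<in> (\<Pi>\<^sub>E i\<in>I. K i k)" if "k < n" for k
    using that triv additive_subgroup.zero_closed[OF ideal.axioms(1)[OF K]]
    by (auto simp: coord_idem_def)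
  then have "?e [^]\<^bsub>P\<^esub> n \<in> ?Q"
    using box coord_idem_carrier by (intro P.pow_mem_ideal_product) auto
  then have "?e [^]\<^bsub>P\<^esub> n \<otimes>\<^bsub>P\<^esub> ?e \<in> ?Q"
    using ideal.I_r_closed[OF Q] coord_idem_carrier by blast
  \<comment> \<open>The extra factor covers the empty product, where the power is \<open>1\<close> instead of the idempotent.\<close>
  moreover have "?e [^]\<^bsub>P\<^esub> m \<otimes>\<^bsub>P\<^esub> ?e = ?e" for m :: nat
    by (induction m) (simp_all add: coord_idem_carrier P.m_assoc coord_idem_mult_self)
  ultimately have "?Q = (\<Pi>\<^sub>E i\<in>I. (\<lambda>x. x i) ` ?Q)"
    using ideal_cofinite_eq_PiE[OF Q F] by simp
  also have "\<dots> = (\<Pi>\<^sub>E i\<in>I. ideal_product (A i) (K i) n)"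
  proof (rule PiE_cong)
    fix i assume i: "i \<in> I"
    interpret Ai: cring "A i" using i by (rule cring_factor)
    interpret Mi: comm_monoid "ideals_set (A i)" by (rule Ai.ideals_set_is_comm_monoid)
    have "(\<lambda>x. x i) ` ?Q = ideal_product (A i) (\<lambda>k. (\<lambda>x. x i) ` (\<Pi>\<^sub>E i\<in>I. K i k)) n"
      using i box by (rule proj_ideal_product)
    also have "\<dots> = ideal_product (A i) (K i) n"
      unfolding ideal_product_def using i K by (intro Mi.finprod_cong') (auto simp: proj_PiE ideals_set_def)
    finally show "(\<lambda>x. x i) ` ?Q = ideal_product (A i) (K i) n" .
  qed
  finally show ?thesis .
qed


section \<open>The SP-property of a direct product\<close>

text \<open>A regular ideal of \<open>A i\<close> is the projection of the regular ideal of \<open>P\<close> that is unrestricted in all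
  other coordinates; projecting a factorization of the latter gives one of the former.\<close>

lemma sp_ring_factor:
  assumes "sp_ring P" and i: "i \<in> I"
  shows "sp_ring (A i)"
proof -
  interpret Ai: cring "A i" using i by (rule cring_factor)
  have "\<exists>(n::nat) K. (\<forall>k<n. radical_ideal (K k) (A i)) \<and> J = ideal_product (A i) K n"
    if "regular_ideal J (A i)" for J
  proof -
    from that obtain r where J: "ideal J (A i)" and r: "r \<in> J" "r \<in> regular_elements (A i)"
      by (auto simp: regular_ideal_def)
    define B where "B j = (if j = i then J else carrier (A j))" for j
    have B: "ideal (B j) (A j)" if "j \<in> I" for j
      using that J ring.oneideal[OF cring.axioms(1)[OF cring_factor]] by (simp add: B_def)
    have "(\<lambda>j\<in>I. if j = i then r else \<one>\<^bsub>A j\<^esub>) \<in> Pi\<^sub>E I B \<inter> regular_elements P"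
      using r cring.one_regular[OF cring_factor] unfolding regular_elements_P
      by (auto simp: B_def)
    then have "regular_ideal (Pi\<^sub>E I B) P"
      using ideal_PiE[of B] B unfolding regular_ideal_def by blast
    then obtain n :: nat and K where K: "\<forall>k<n. radical_ideal (K k) P"
      and eq: "Pi\<^sub>E I B = ideal_product P K n"
      using sp_ring.product_of_radical[OF assms(1), folded ideal_product_def] by blast
    have "J = (\<lambda>x. x i) ` Pi\<^sub>E I B"
      using proj_PiE[of B i] B i by (simp add: B_def)
    also have "\<dots> = ideal_product (A i) (\<lambda>k. (\<lambda>x. x i) ` K k) n"
      unfolding eq using K i by (intro proj_ideal_product) (auto simp: radical_ideal_def)
    finally show ?thesis
      using proj_radical_ideal[OF _ i] K
      by (intro exI[of _ n] exI[of _ "\<lambda>k. (\<lambda>x. x i) ` K k"]) simp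
  qed
  then show ?thesis by unfold_locales (simp add: ideal_product_def)
qed

text \<open>Otherwise the exponents along a sequence \<open>f\<close> of factors with regular non-units can be made unbounded,
  so that no fixed number of radical factors is enough for all coordinates at once.\<close>

lemma sp_ring_finite_nonquotient:
  assumes "sp_ring P"
  shows "finite {i \<in> I. \<not> total_quotient_ring (A i)}" (is "finite ?N")
proof (rule ccontr)
  assume "infinite ?N"
  then obtain f :: "nat \<Rightarrow> 'i" where f: "inj f" "range f \<subseteq> ?N"
    using infinite_countable_subset by blast
  have "\<exists>a \<in> regular_elements (A i). i \<in> ?N \<longrightarrow> a \<notin> Units (A i)" if i: "i \<in> I" for i
  proof -
    have "\<one>\<^bsub>A i\<^esub> \<in> regular_elements (A i)"
      using i by (intro cring.one_regular cring_factor)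
    then show ?thesis
      using cring_factor[OF i]
      by (auto simp: total_quotient_ring_def total_quotient_ring_axioms_def)
  qed
  then obtain a where a: "\<And>i. i \<in> I \<Longrightarrow> a i \<in> regular_elements (A i)"
    and nonunit: "\<And>i. i \<in> ?N \<Longrightarrow> a i \<notin> Units (A i)"
    by (metis (mono_tags, lifting) mem_Collect_eq)
  \<comment> \<open>The exponent at the coordinate \<open>f n\<close> is \<open>n\<close>. Off the range of \<open>f\<close> it is an arbitrary number,
    which is harmless because powers of regular elements are regular.\<close>
  define r where "r = (\<lambda>i\<in>I. a i [^]\<^bsub>A i\<^esub> inv_into UNIV f i)"
  have r: "r \<in> regular_elements P"
    unfolding regular_elements_P r_def using cring.regular_pow[OF cring_factor a] by auto
  note rc = regular_closed[OF r]
  have "regular_ideal (PIdl\<^bsub>P\<^esub> r) P"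
    using r P.cgenideal_ideal[OF rc] P.cgenideal_self[OF rc] by (auto simp: regular_ideal_def)
  then obtain m :: nat and K where K: "\<forall>k<m. radical_ideal (K k) P"
    and eq: "PIdl\<^bsub>P\<^esub> r = ideal_product P K m"
    using sp_ring.product_of_radical[OF assms, folded ideal_product_def] by blast
  define i where "i = f (Suc m)"
  have iN: "i \<in> ?N" using f by (auto simp: i_def)
  then have i: "i \<in> I" by simp
  interpret h: ring_hom_cring P "A i" "\<lambda>x. x i" using i by (rule proj_hom)
  have "r i = a i [^]\<^bsub>A i\<^esub> Suc m"
    using i f(1) by (simp only: r_def i_def restrict_apply' inv_f_f)
  then have "PIdl\<^bsub>A i\<^esub> (a i [^]\<^bsub>A i\<^esub> Suc m) = (\<lambda>x. x i) ` (PIdl\<^bsub>P\<^esub> r)"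
    using h.image_cgenideal[OF proj_surj[OF i] rc] by simp
  also have "\<dots> = ideal_product (A i) (\<lambda>k. (\<lambda>x. x i) ` K k) m"
    unfolding eq using K i by (intro proj_ideal_product) (auto simp: radical_ideal_def)
  finally have "a i \<in> Units (A i)"
    using K proj_radical_ideal[OF _ i] a[OF i]
    by (intro h.S.unit_if_pow_ideal_is_short_product[of _ m "Suc m"]) auto
  then show False using nonunit iN by blast
qed

text \<open>A regular ideal is a box that is the whole ring in all but finitely many coordinates. Its finitely
  many other projections are factored separately and padded to a common length.\<close>

lemma sp_ring_product:
  assumes sp: "\<And>i. i \<in> I \<Longrightarrow> sp_ring (A i)"
    and F: "finite {i \<in> I. \<not> total_quotient_ring (A i)}" (is "finite ?F")
  shows "sp_ring P"
proof -
  have "\<exists>(n::nat) K. (\<forall>k<n. radical_ideal (K k) P) \<and> J = ideal_product P K n"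
    if "regular_ideal J P" for J
  proof -
    from that obtain r where J: "ideal J P" and r: "r \<in> J" "r \<in> regular_elements P"
      by (auto simp: regular_ideal_def)
    let ?J = "\<lambda>i. (\<lambda>x. x i) ` J"
    have r_reg: "r i \<in> regular_elements (A i)" if "i \<in> I" for i
      using r(2) that by (auto simp: regular_elements_P)
    have "r i \<in> Units (A i)" if "i \<in> I - ?F" for i
      using that r_reg by (auto dest: total_quotient_ring.regular_is_unit)
    then have "\<exists>y\<in>carrier (A i). r i \<otimes>\<^bsub>A i\<^esub> y = \<one>\<^bsub>A i\<^esub>" if "i \<in> I - ?F" for i
      using that by (auto simp: Units_def)
    then obtain y where y: "\<And>i. i \<in> I - ?F \<Longrightarrow> y i \<in> carrier (A i) \<and> r i \<otimes>\<^bsub>A i\<^esub> y i = \<one>\<^bsub>A i\<^esub>"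
      by metis
    \<comment> \<open>The inverse of \<open>r\<close> wherever \<open>r\<close> is known to be a unit, and \<open>0\<close> elsewhere.\<close>
    define z where "z = (\<lambda>i\<in>I. if i \<in> ?F then \<zero>\<^bsub>A i\<^esub> else y i)"
    have "z \<in> carrier P" using y by (auto simp: z_def carrier_P)
    then have "r \<otimes>\<^bsub>P\<^esub> z \<in> J" by (rule ideal.I_r_closed[OF J r(1)])
    moreover have "r \<otimes>\<^bsub>P\<^esub> z = coord_idem (- ?F)"
      using y regular_closed[OF r_reg] by (auto simp: z_def mult_P coord_idem_def fun_eq_iff)
    ultimately have e: "coord_idem (- ?F) \<in> J" by simp
    have Ji: "ideal (?J i) (A i)" if "i \<in> I" for i
      using ring_hom_cring.ideal_image[OF proj_hom proj_surj J] that by blast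
    then have "regular_ideal (?J i) (A i)" if "i \<in> I" for i
      using that r r_reg by (auto simp: regular_ideal_def)
    then have "\<exists>(n::nat) K. (\<forall>k<n. radical_ideal (K k) (A i)) \<and> ?J i = ideal_product (A i) K n"
      if "i \<in> I" for i
      using sp_ring.product_of_radical[OF sp, folded ideal_product_def] that by blast
    then obtain n :: "'i \<Rightarrow> nat" and K where
      K: "\<And>i k. i \<in> I \<Longrightarrow> k < n i \<Longrightarrow> radical_ideal (K i k) (A i)"
      and eq: "\<And>i. i \<in> I \<Longrightarrow> ?J i = ideal_product (A i) (K i) (n i)"
      by metis
    define N where "N = Max (insert 0 (n ` ?F))"
    \<comment> \<open>Outside \<open>?F\<close> the factorization from \<open>K\<close> is discarded: its length may be unbounded there,
      while the projection of \<open>J\<close> is the whole ring and needs no factors.\<close>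
    define L where "L i k = (if i \<in> ?F \<and> k < n i then K i k else carrier (A i))" for i k
    have L: "radical_ideal (L i k) (A i)" if "i \<in> I" for i k
    proof -
      interpret Ai: cring "A i" using that by (rule cring_factor)
      have "radical_ideal (carrier (A i)) (A i)"
        by (simp add: Ai.radical_ideal_iff Ai.oneideal)
      then show ?thesis using that K by (simp add: L_def)
    qed
    have prod_L: "ideal_product (A i) (L i) N = ?J i" if i: "i \<in> I" for i
    proof -
      interpret Ai: cring "A i" using i by (rule cring_factor)
      show ?thesis
      proof (cases "i \<in> ?F")
        case True
        then have "n i \<le> N" using F by (auto simp: N_def intro!: Max_ge)
        moreover have "L i = (\<lambda>k. if k < n i then K i k else carrier (A i))"
          using True by (auto simp: L_def)
        ultimately show ?thesis
          using Ai.ideal_product_pad[of "n i" "K i" N] K[OF i] eq[OF i]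
          by (simp add: radical_ideal_def)
      next
        case False
        then have "L i = (\<lambda>k. carrier (A i))" by (auto simp: L_def)
        then have "ideal_product (A i) (L i) N = carrier (A i)"
          using Ai.ideal_product_pad[of 0 "K i" N] by (simp add: Ai.ideal_product_0)
        moreover have "\<one>\<^bsub>A i\<^esub> \<in> ?J i"
          using e False i by (intro image_eqI[OF _ e]) (simp add: coord_idem_def)
        ultimately show ?thesis
          using ideal.one_imp_carrier[OF Ji[OF i]] by simp
      qed
    qed
    have "J = (\<Pi>\<^sub>E i\<in>I. ?J i)"
      using J F e by (rule ideal_cofinite_eq_PiE)
    also have "\<dots> = (\<Pi>\<^sub>E i\<in>I. ideal_product (A i) (L i) N)"
      using prod_L by (intro PiE_cong) simp
    also have "\<dots> = ideal_product P (\<lambda>k. \<Pi>\<^sub>E i\<in>I. L i k) N"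
      using L F by (intro ideal_product_PiE[symmetric, where F = ?F])
        (auto simp: radical_ideal_def L_def)
    finally have "J = ideal_product P (\<lambda>k. \<Pi>\<^sub>E i\<in>I. L i k) N" .
    moreover have "radical_ideal (\<Pi>\<^sub>E i\<in>I. L i k) P" for k
      using L by (rule radical_PiE)
    ultimately show ?thesis
      by (intro exI[of _ N] exI[of _ "\<lambda>k. \<Pi>\<^sub>E i\<in>I. L i k"]) simp
  qed
  then show ?thesis by unfold_locales (simp add: ideal_product_def)
qed

end

theorem corollary2p16:
  fixes I :: "'i set" and A :: "'i \<Rightarrow> ('a, 'm) ring_scheme"
  assumes "\<And>i. i \<in> I \<Longrightarrow> marot_ring (A i)"
    and "marot_ring (product_ring I A)"
  shows "sp_ring (product_ring I A) \<longleftrightarrow>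
           (\<forall>i\<in>I. sp_ring (A i)) \<and> finite {i \<in> I. \<not> total_quotient_ring (A i)}"
proof -
  interpret cring_family I A
    using assms(1) by (intro cring_family.intro) (simp add: marot_ring_def)
  show ?thesis
    using sp_ring_factor sp_ring_finite_nonquotient sp_ring_product by blast
qed

end
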